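(* Let $\phi=\frac{1+\sqrt5}{2}$. Then $$\operatorname{Li}_2\left(\frac12\sqrt{\phi^2+3\phi}-\frac{\phi^2+1}{2\phi}\right)-\operatorname{Li}_2\left(\frac{1}{2\phi^2}+\frac12\sqrt{\frac{\phi^2+2}{\phi^3}}\right)=-\frac{\pi^2}{15}+\ln^2(\phi)-\ln\left(\frac{\phi^2}{2}+\frac12\sqrt{\frac{\phi^2+2}{\phi}}\right)\ln\left(\frac12\phi+\frac12\sqrt{\frac{\phi^2+2}{\phi^3}}\right).$$
   Context: $\operatorname{Li}_2(z)=\sum_{k\ge1}z^k/k^2$ for $|z|\le 1$ is the dilogarithm; $\ln$ is the natural logarithm and $\ln^2(y)=(\ln y)^2$. *)

theory Defs
  imports Complex_Main
begin

text \<open>The series is indexed from \<open>0\<close>, so the index \<open>k\<close> of the usual series is \<open>Suc k\<close> here.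
  It converges absolutely for \<open>norm z \<le> 1\<close>; outside the closed unit disc the value is a junk
  value of \<^const>\<open>suminf\<close>.\<close>

definition dilog :: "'a \<Rightarrow> 'a::{real_normed_field, banach}" where
  "dilog z = (\<Sum>k. z ^ Suc k / of_nat (Suc k) ^ 2)"

definition golden_ratio :: real where
  "golden_ratio = (1 + sqrt 5) / 2"

end

theory Submission
  imports Defs "HOL-Analysis.Gamma_Function" "HOL-Real_Asymp.Real_Asymp"
begin

text \<open>
  Write \<open>u = 1/\<phi>\<close>, so that \<open>1 - u\<^sup>2 = u\<close>. The second argument \<open>b\<close> is the positive root of
  \<open>b\<^sup>2 = u\<^sup>2 b + u\<^sup>3\<close>. In Abel's five-term relation for \<open>x = b\<close> and \<open>y = u\<^sup>2 / b\<close> one has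
  \<open>x y = u\<^sup>2\<close>, while \<open>x (1 - y) / (1 - x y) = y\<close> and \<open>y (1 - x) / (1 - x y)\<close> is the first argument,
  so two of the five terms cancel. The remaining value \<open>Li\<^sub>2(u\<^sup>2) = \<pi>\<^sup>2/15 - ln\<^sup>2 \<phi>\<close> comes from the
  five-term relation at \<open>x = y = u\<close> combined with the reflection formula.
\<close>

section \<open>The real dilogarithm on the unit interval\<close>

lemma dilog_0 [simp]: "dilog 0 = 0"
  by (simp add: dilog_def)

lemma dilog_1: "dilog (1 :: real) = pi\<^sup>2 / 6"
  using inverse_squares_sums by (simp add: dilog_def sums_iff add.commute)

text \<open>The majorant \<open>1 / k^2\<close> is summable, so convergence is uniform up to the
  endpoints. This gives access to the values at 0 and 1, which \<open>DERIV_dilog\<close> leaves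
  out.\<close>

lemma continuous_on_dilog: "continuous_on {-1..1} (dilog :: real \<Rightarrow> real)"
proof -
  have "uniform_limit {-1..1} (\<lambda>n x. \<Sum>k<n. x ^ Suc k / of_nat (Suc k) ^ 2)
          (\<lambda>x :: real. \<Sum>k. x ^ Suc k / of_nat (Suc k) ^ 2) sequentially"
  proof (rule Weierstrass_m_test)
    show "summable (\<lambda>k. 1 / real (Suc k) ^ 2)"
      using inverse_squares_sums by (simp add: sums_iff add.commute)
  next
    fix k and x :: real
    assume "x \<in> {-1..1}"
    then have "\<bar>x ^ Suc k\<bar> \<le> 1"
      unfolding power_abs by (intro power_le_one) auto
    then show "norm (x ^ Suc k / of_nat (Suc k) ^ 2) \<le> 1 / real (Suc k) ^ 2"
      by (simp add: divide_right_mono del: power_Suc)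
  qed
  then have "continuous_on {-1..1} (\<lambda>x :: real. \<Sum>k. x ^ Suc k / of_nat (Suc k) ^ 2)"
    by (rule uniform_limit_theorem [rotated]) (auto intro!: always_eventually continuous_intros)
  then show ?thesis
    by (simp add: dilog_def [abs_def])
qed

text \<open>Termwise differentiation turns the series into that of \<open>- ln (1 - x)\<close>,
  divided by \<open>x\<close>. At \<open>x = 0\<close> the quotient would evaluate to 0, whereas the
  derivative there is 1.\<close>

lemma DERIV_dilog:
  fixes x :: real
  assumes "x \<noteq> 0" "\<bar>x\<bar> < 1"
  shows "(dilog has_real_derivative - ln (1 - x) / x) (at x)"
proof -
  \<comment> \<open>Here \<open>c 0 = 1 / 0 = 0\<close>, so the power series indexed from 0 has the
    same sum as the shifted series of \<open>dilog\<close>.\<close>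
  define c :: "nat \<Rightarrow> real" where "c k = 1 / real k ^ 2" for k
  have shift: "c (Suc k) * z ^ Suc k = z ^ Suc k / of_nat (Suc k) ^ 2" for k z
    by (simp add: c_def)
  have summ: "summable (\<lambda>k. c k * z ^ k)" if "\<bar>z\<bar> < 1" for z
  proof (rule summable_comparison_test')
    show "summable (\<lambda>k. \<bar>z\<bar> ^ k)"
      using that by (simp add: summable_geometric)
    show "norm (c k * z ^ k) \<le> \<bar>z\<bar> ^ k" if "k \<ge> 1" for k
    proof -
      have "1 \<le> real k ^ 2"
        using that by (simp add: one_le_power)
      then show ?thesis
        by (simp add: c_def abs_mult power_abs divide_le_eq mult_left_le_one_le mult_le_cancel_left1)
    qed
  qed
  have "dilog z = (\<Sum>k. c k * z ^ k)" if "\<bar>z\<bar> < 1" for z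
    using suminf_split_head [OF summ [OF that]] unfolding shift by (simp add: dilog_def c_def)
  then have eq: "\<And>z. z \<in> {-1<..<1} \<Longrightarrow> (\<Sum>k. c k * z ^ k) = dilog z"
    by (simp add: abs_less_iff)
  have "((\<lambda>z. \<Sum>k. c k * z ^ k) has_real_derivative (\<Sum>k. diffs c k * x ^ k)) (at x)"
    using termdiffs_strong' [of 1 c x] summ assms(2) by simp
  then have D: "(dilog has_real_derivative (\<Sum>k. diffs c k * x ^ k)) (at x)"
    by (rule has_field_derivative_transform_within_open [where S = "{-1<..<1}"])
      (use assms(2) eq in \<open>auto simp: abs_less_iff\<close>)
  have "(\<lambda>k. - (x ^ k / of_nat k)) sums ln (1 - x)"
    using ln_series' [of "- x"] assms(2) by simp
  then have "(\<lambda>k. x ^ k / of_nat k) sums - ln (1 - x)"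
    using sums_minus by fastforce
  \<comment> \<open>The shift loses nothing, because the term at \<open>k = 0\<close> is a division
    by zero, hence 0.\<close>
  then have "(\<lambda>k. x ^ Suc k / of_nat (Suc k)) sums - ln (1 - x)"
    using sums_Suc_iff [of "\<lambda>k. x ^ k / of_nat k" "- ln (1 - x)"] by simp
  then have "(\<lambda>k. x ^ Suc k / of_nat (Suc k) / x) sums (- ln (1 - x) / x)"
    by (rule sums_divide)
  moreover have "x ^ Suc k / of_nat (Suc k) / x = diffs c k * x ^ k" for k
    using assms(1) by (simp add: diffs_def c_def power2_eq_square)
  ultimately have "(\<Sum>k. diffs c k * x ^ k) = - ln (1 - x) / x"
    by (simp add: sums_iff)
  with D show ?thesis
    by simp
qed

lemma DERIV_dilog_chain:
  fixes f :: "real \<Rightarrow> real"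
  assumes "(f has_real_derivative d) (at x)" "0 < f x" "f x < 1"
  shows "((\<lambda>t. dilog (f t)) has_real_derivative - ln (1 - f x) / f x * d) (at x)"
  using DERIV_chain2 [OF DERIV_dilog assms(1)] assms(2,3) by simp

text \<open>Moving the logarithms to the left gives a function with zero derivative on the open
  interval. Its constant value is its limit at 0 from the right, where the product of logarithms
  vanishes and \<open>dilog 1\<close> remains.\<close>

theorem dilog_reflection:
  fixes x :: real
  assumes "0 < x" "x < 1"
  shows "dilog x + dilog (1 - x) = pi\<^sup>2 / 6 - ln x * ln (1 - x)"
proof -
  define f where "f t = dilog t + dilog (1 - t) + ln t * ln (1 - t)" for t :: real
  have D: "(f has_real_derivative 0) (at t)" if "t > 0" "t < 1" for t
    unfolding f_def
    by (rule derivative_eq_intros DERIV_dilog_chain refl | use that in \<open>simp\<close>)+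
  have const: "f t = f x" if "t > 0" "t < 1" for t
  proof (cases "t = x")
    case False
    \<comment> \<open>Using \<open>min\<close> and \<open>max\<close> treats both orders of
      \<open>t\<close> and \<open>x\<close> at once.\<close>
    have "f (max t x) = f (min t x)"
    proof (rule DERIV_isconst_end [where f = f])
      show "min t x < max t x"
        using False by auto
      show "continuous_on {min t x..max t x} f"
        by (rule DERIV_continuous_on [where D = "\<lambda>_. 0"], rule has_field_derivative_at_within, rule D)
          (use that assms in auto)
    qed (use that assms D in auto)
    then show ?thesis
      by (auto simp: max_def min_def split: if_splits)
  qed auto
  have cont: "((\<lambda>t. dilog (g t)) \<longlongrightarrow> dilog (g 0)) (at_right 0)"
    if "continuous_on {0..1} g" "\<And>t. t \<in> {0..1} \<Longrightarrow> g t \<in> {0..1}" for g :: "real \<Rightarrow> real"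
  proof -
    have "continuous_on {0..1} (\<lambda>t. dilog (g t))"
      by (rule continuous_on_compose2 [OF continuous_on_dilog that(1)]) (use that(2) in force)
    then have "((\<lambda>t. dilog (g t)) \<longlongrightarrow> dilog (g 0)) (at 0 within {0..1})"
      by (auto simp: continuous_on_def)
    then show ?thesis
      by (simp add: at_within_Icc_at_right)
  qed
  have "(f \<longlongrightarrow> dilog 0 + dilog (1 - 0) + 0) (at_right 0)"
    unfolding f_def
    by (intro tendsto_add cont) (auto intro!: continuous_intros, real_asymp)
  moreover have "\<forall>\<^sub>F t in at_right 0. f t = f x"
    using eventually_at_right_real [of 0 1] by (rule eventually_mono) (auto intro: const)
  then have "(f \<longlongrightarrow> f x) (at_right 0)"
    by (rule tendsto_eventually)
  ultimately have "f x = pi\<^sup>2 / 6"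
    using tendsto_unique [OF trivial_limit_at_right_real] by (fastforce simp: dilog_1)
  then show ?thesis
    by (simp add: f_def)
qed

text \<open>With \<open>y\<close> fixed, the difference of the two sides has zero derivative in the
  first variable. It vanishes at 0, where \<open>p\<close> is 0 and \<open>q\<close> is
  \<open>y\<close>.\<close>

theorem dilog_five_term:
  fixes x y :: real
  assumes x: "0 < x" "x < 1" and y: "0 < y" "y < 1"
  shows "dilog x + dilog y - dilog (x * y)
    = dilog (x * (1 - y) / (1 - x * y)) + dilog (y * (1 - x) / (1 - x * y))
      + ln ((1 - x) / (1 - x * y)) * ln ((1 - y) / (1 - x * y))"
proof -
  define p where "p t = t * (1 - y) / (1 - t * y)" for t
  define q where "q t = y * (1 - t) / (1 - t * y)" for t
  \<comment> \<open>The logarithms of quotients are split into differences, which are easier to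
    differentiate; \<open>ln_div\<close> restores the quotients at the end.\<close>
  define f where "f t = dilog t + dilog y - dilog (t * y) - dilog (p t) - dilog (q t)
    - (ln (1 - t) - ln (1 - t * y)) * (ln (1 - y) - ln (1 - t * y))" for t
  have ty: "t * y < 1" if "t \<ge> 0" "t < 1" for t
    using mult_left_le [of y t] that y by linarith
  have p1: "1 - p t = (1 - t) / (1 - t * y)" and q1: "1 - q t = (1 - y) / (1 - t * y)"
    if "t \<ge> 0" "t < 1" for t
    using ty [OF that] by (simp_all add: p_def q_def field_simps)
  have p_bounds: "0 \<le> p t" "p t < 1" and q_bounds: "0 \<le> q t" "q t < 1"
    if "t \<ge> 0" "t < 1" for t
  proof -
    have "1 - p t > 0" "1 - q t > 0"
      unfolding p1 [OF that] q1 [OF that] using ty [OF that] that y by simp_all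
    then show "p t < 1" "q t < 1"
      by simp_all
    show "0 \<le> p t" "0 \<le> q t"
      using ty [OF that] that y by (simp_all add: p_def q_def)
  qed
  have "f x = f 0"
  \<comment> \<open>The derivative is taken only for \<open>0 < t\<close>; at \<open>t = 0\<close>,
    where \<open>p t = 0\<close>, the rule asks for continuity alone.\<close>
  proof (rule DERIV_isconst_end [where f = f, OF x(1)])
    have dom: "t < 1" "0 < 1 - t * y" "t * y \<in> {-1..1}" "p t \<in> {-1..1}" "q t \<in> {-1..1}" "t \<in> {-1..1}"
      if "t \<in> {0..x}" for t
    proof -
      have "0 \<le> t" "t < 1" "0 \<le> t * y"
        using that x y by simp_all
      then show "t < 1" "0 < 1 - t * y" "t * y \<in> {-1..1}" "p t \<in> {-1..1}" "q t \<in> {-1..1}" "t \<in> {-1..1}"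
        using p_bounds [of t] q_bounds [of t] ty [of t] by auto
    qed
    have cont_dilog: "continuous_on {0..x} (\<lambda>t. dilog (g t))"
      if "continuous_on {0..x} g" "\<And>t. t \<in> {0..x} \<Longrightarrow> g t \<in> {-1..1}" for g :: "real \<Rightarrow> real"
      using continuous_on_compose2 [OF continuous_on_dilog that(1)] that(2) by blast
    have "1 - t * y \<noteq> 0" "1 - t \<noteq> 0" if "t \<in> {0..x}" for t
      using dom [OF that] by auto
    then have "continuous_on {0..x} p" "continuous_on {0..x} q"
      "continuous_on {0..x} (\<lambda>t. ln (1 - t))" "continuous_on {0..x} (\<lambda>t. ln (1 - t * y))"
      unfolding p_def q_def using x by (auto intro!: continuous_intros)
    then show "continuous_on {0..x} f"
      unfolding f_def
      by (intro continuous_on_diff continuous_on_add continuous_on_mult continuous_on_const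
        cont_dilog continuous_on_id dom) auto
  next
    fix t
    assume t: "0 < t" "t < x"
    then have t1: "t < 1" using x by simp
    note b = ty [of t]
    define A where "A = ln (1 - t)"
    define B where "B = ln (1 - y)"
    define D where "D = ln (1 - t * y)"
    have lnp: "ln (1 - p t) = A - D" and lnq: "ln (1 - q t) = B - D"
      using p1 [of t] q1 [of t] t t1 y b by (simp_all add: A_def B_def D_def ln_div)
    have pt: "0 < p t" "p t < 1" and qt: "0 < q t" "q t < 1"
      using p_bounds [of t] q_bounds [of t] t t1 y b by (auto simp: p_def q_def)
    \<comment> \<open>The right-hand sides are what the quotient rule yields. The left-hand sides
      show \<open>p\<close> and \<open>q\<close> times their logarithmic derivatives, so that the
      factors \<open>1 / p t\<close> and \<open>1 / q t\<close> from the chain rule cancel.\<close>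
    have alg_p: "t * v / w * (1 / t + y / w) = (v * w - t * v * - y) / (w * w)"
      and alg_q: "y * v / w * (- 1 / v + y / w) = (- y * w - y * v * - y) / (w * w)"
      if "v \<noteq> 0" "w \<noteq> 0" for v w
      using that t by (simp_all add: field_simps)
    have lin: "((\<lambda>t. t * (1 - y)) has_real_derivative 1 - y) (at t)"
      "((\<lambda>t. y * (1 - t)) has_real_derivative - y) (at t)"
      "((\<lambda>t. 1 - t * y) has_real_derivative - y) (at t)"
      by (auto intro!: derivative_eq_intros)
    have Dp: "(p has_real_derivative p t * (1 / t + y / (1 - t * y))) (at t)"
      using DERIV_divide [OF lin(1,3)] t t1 y b
      unfolding p_def [abs_def] by (subst alg_p) simp_all
    have Dq: "(q has_real_derivative q t * (- 1 / (1 - t) + y / (1 - t * y))) (at t)"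
      using DERIV_divide [OF lin(2,3)] t t1 y b
      unfolding q_def [abs_def] by (subst alg_q) simp_all
    have dp: "((\<lambda>t. dilog (p t)) has_real_derivative (D - A) * (1 / t + y / (1 - t * y))) (at t)"
      using DERIV_dilog_chain [OF Dp pt] pt by (simp add: lnp)
    have dq: "((\<lambda>t. dilog (q t)) has_real_derivative
        (D - B) * (- 1 / (1 - t) + y / (1 - t * y))) (at t)"
      using DERIV_dilog_chain [OF Dq qt] qt by (simp add: lnq)
    have dt: "(dilog has_real_derivative - A / t) (at t)"
      using DERIV_dilog [of t] t t1 by (simp add: A_def)
    have "((\<lambda>t. t * y) has_real_derivative y) (at t)"
      by (auto intro!: derivative_eq_intros)
    from DERIV_dilog_chain [OF this]
    have dty: "((\<lambda>t. dilog (t * y)) has_real_derivative - D / t) (at t)"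
      using t y b t1 by (simp add: D_def)
    have dA: "((\<lambda>t. ln (1 - t)) has_real_derivative - 1 / (1 - t)) (at t)"
      using t1 by (auto intro!: derivative_eq_intros)
    have dD: "((\<lambda>t. ln (1 - t * y)) has_real_derivative - y / (1 - t * y)) (at t)"
      using t t1 b by (auto intro!: derivative_eq_intros)
    have deriv: "(f has_real_derivative
        - A / t + 0 - - D / t - (D - A) * (1 / t + y / (1 - t * y))
        - (D - B) * (- 1 / (1 - t) + y / (1 - t * y))
        - ((- 1 / (1 - t) - - y / (1 - t * y)) * (B - D) + (0 - - y / (1 - t * y)) * (A - D))) (at t)"
      unfolding f_def A_def B_def D_def
      by (intro DERIV_add DERIV_diff DERIV_mult DERIV_const
        dp [unfolded A_def D_def] dq [unfolded B_def D_def] dt [unfolded A_def] dty [unfolded D_def] dA dD)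
    \<comment> \<open>With the two fractions replaced by free \<open>Y\<close> and \<open>V\<close>,
      the cancellation needs only ring arithmetic and the common denominator
      \<open>t\<close>.\<close>
    have "- A / t + 0 - - D / t - (D - A) * (1 / t + Y) - (D - B) * (V + Y)
        - ((V + Y) * (B - D) + (0 + Y) * (A - D)) = 0" for V Y
      by (simp add: algebra_simps diff_divide_distrib)
    from deriv this [of "y / (1 - t * y)" "- 1 / (1 - t)"]
    show "(f has_real_derivative 0) (at t)"
      by (simp only: minus_divide_left [symmetric] diff_minus_eq_add)
  qed
  also have "f 0 = 0"
    by (simp add: f_def p_def q_def)
  finally show ?thesis
    using ty [of x] x y by (simp add: f_def p_def q_def ln_div)
qed

section \<open>The golden ratio\<close>

lemma golden_ratio_gt_1: "golden_ratio > 1"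
  by (simp add: golden_ratio_def)

lemma golden_ratio_squared: "golden_ratio\<^sup>2 = golden_ratio + 1"
  by (simp add: golden_ratio_def power2_eq_square field_simps)

lemma dilog_inverse_golden_ratio_squared:
  "dilog (1 / golden_ratio\<^sup>2) = pi\<^sup>2 / 15 - (ln golden_ratio)\<^sup>2"
proof -
  define u where "u = 1 / golden_ratio"
  have u: "0 < u" "u < 1"
    using golden_ratio_gt_1 by (simp_all add: u_def)
  have u2: "u * u = 1 - u"
    using golden_ratio_gt_1 golden_ratio_squared by (simp add: u_def power2_eq_square field_simps)
  have den: "1 - u * u = u"
    using u2 by simp
  \<comment> \<open>Since \<open>1 - u^2 = u\<close>, both new arguments of the five-term relation
    at \<open>x = y = u\<close> are \<open>u^2 = 1 - u\<close>. This and reflection are two linear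
    equations for \<open>dilog u\<close> and \<open>dilog (1 - u)\<close>.\<close>
  have "(1 - u) / (1 - u * u) = u" "u * (1 - u) / (1 - u * u) = u * u"
    unfolding den unfolding u2 [symmetric] using u by simp_all
  then have five: "2 * dilog u = 3 * dilog (1 - u) + (ln u)\<^sup>2"
    using dilog_five_term [OF u u] u2 by (simp add: power2_eq_square)
  have "ln (1 - u) = 2 * ln u"
    using u ln_mult [of u u] by (simp add: u2)
  then have "dilog u + dilog (1 - u) = pi\<^sup>2 / 6 - 2 * (ln u)\<^sup>2"
    using dilog_reflection [OF u] by (simp add: power2_eq_square)
  with five have "dilog (1 - u) = pi\<^sup>2 / 15 - (ln u)\<^sup>2"
    by linarith
  moreover have "1 / golden_ratio\<^sup>2 = 1 - u"
    using u2 by (simp add: u_def power2_eq_square)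
  moreover have "ln u = - ln golden_ratio"
    using golden_ratio_gt_1 by (simp add: u_def ln_div)
  ultimately show ?thesis
    by simp
qed

theorem theorem14:
  fixes \<phi> :: real
  defines "\<phi> \<equiv> golden_ratio"
  shows "dilog (1/2 * sqrt (\<phi>^2 + 3 * \<phi>) - (\<phi>^2 + 1) / (2 * \<phi>))
           - dilog (1 / (2 * \<phi>^2) + 1/2 * sqrt ((\<phi>^2 + 2) / \<phi>^3))
         = - (pi^2 / 15) + (ln \<phi>)^2
           - ln (\<phi>^2 / 2 + 1/2 * sqrt ((\<phi>^2 + 2) / \<phi>))
             * ln (1/2 * \<phi> + 1/2 * sqrt ((\<phi>^2 + 2) / \<phi>^3))"
proof -
  have phi: "\<phi> > 1" and phi2: "\<phi>\<^sup>2 = \<phi> + 1"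
    using golden_ratio_gt_1 golden_ratio_squared by (simp_all add: \<phi>_def)
  \<comment> \<open>The relations \<open>\<phi> = 1 + u\<close> and \<open>u^2 = 1 - u\<close>
    reduce the algebra below to polynomial identities in \<open>u\<close>, \<open>b\<close> and
    \<open>s\<close>.\<close>
  define u where "u = 1 / \<phi>"
  have u: "0 < u" "u < 1"
    using phi by (simp_all add: u_def)
  have phi_u: "\<phi> = 1 + u"
    using phi phi2 by (simp add: u_def power2_eq_square field_simps)
  have u2: "u\<^sup>2 = 1 - u"
    using phi phi2 by (simp add: u_def power2_eq_square field_simps)
  have inv: "(1 + u) * u = 1"
    using u2 by (simp add: power2_eq_square algebra_simps)
  define s where "s = sqrt ((\<phi>\<^sup>2 + 2) / \<phi>^3)"
  define b where "b = (1 - u + s) / 2"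
  have s_b: "s = 2 * b - 1 + u"
    by (simp add: b_def field_simps)
  have pos: "(\<phi>\<^sup>2 + 2) / \<phi>^3 > 0"
    using phi by (simp add: pos_add_strict)
  have "(\<phi>\<^sup>2 + 2) / \<phi>^3 = (\<phi>\<^sup>2 + 2) * u * u\<^sup>2"
    by (simp add: u_def power2_eq_square power3_eq_cube)
  also have "\<dots> = 5 * u - 2"
    unfolding phi2 phi_u using u2 by algebra
  finally have s2: "s\<^sup>2 = 5 * u - 2"
    using pos by (simp add: s_def)
  have s0: "s > 0"
    using pos by (simp add: s_def)
  \<comment> \<open>This is \<open>(2 * b - u^2)^2 = s^2\<close> expanded: the discriminant
    \<open>u^4 + 4 * u^3\<close> reduces to \<open>5 * u - 2\<close>.\<close>
  have quad: "b\<^sup>2 = u\<^sup>2 * b + u^3"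
  proof -
    have "4 * b\<^sup>2 = 4 * (u\<^sup>2 * b + u^3)"
      using s_b s2 u2 by algebra
    then show ?thesis
      by simp
  qed
  \<comment> \<open>This bound is equivalent to \<open>b < 1\<close>.\<close>
  have "s < 1 + u"
  proof (rule power2_less_imp_less)
    have "(1 + u)\<^sup>2 = 2 + u"
      using u2 by (simp add: power2_sum)
    then show "s\<^sup>2 < (1 + u)\<^sup>2"
      unfolding s2 using u by linarith
  qed (use u in simp)
  then have b: "0 < b" "b < 1"
    using u s0 by (simp_all add: b_def)
  define y where "y = u\<^sup>2 / b"
  have prod: "b * y = u\<^sup>2"
    using b by (simp add: y_def)
  \<comment> \<open>This is \<open>quad\<close> divided by \<open>b\<close>. It will make one new
    argument of the five-term relation equal to \<open>y\<close>, because
    \<open>b - b * y = b - u^2\<close>.\<close>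
  have yu: "y * u = b - u\<^sup>2"
    using b quad by (simp add: y_def field_simps power2_eq_square power3_eq_cube)
  have y1: "1 - y = (1 - b) * \<phi>"
    unfolding phi_u using yu inv u2 by algebra
  have y: "0 < y" "y < 1"
  proof -
    show "0 < y"
      using u b by (simp add: y_def)
    have "1 - y > 0"
      unfolding y1 using b phi by simp
    then show "y < 1"
      by simp
  qed
  have den: "1 - b * y = u"
    using prod u2 by simp
  have five: "dilog b + dilog y - dilog (u\<^sup>2)
      = dilog (b * (1 - y) / u) + dilog (y * (1 - b) / u) + ln ((1 - b) / u) * ln ((1 - y) / u)"
    using dilog_five_term [OF b y, unfolded den] unfolding prod by simp
  have e1: "b * (1 - y) / u = y"
    using u yu prod by (simp add: field_simps)
  have sqrt1: "sqrt ((\<phi>\<^sup>2 + 2) / \<phi>) = \<phi> * s"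
    using phi by (simp add: s_def real_sqrt_divide real_sqrt_mult power3_eq_cube)
  \<comment> \<open>The radicand is a square times \<open>s^2\<close>, so all three radicals of the
    theorem are multiples of \<open>s\<close>.\<close>
  have "\<phi>\<^sup>2 + 3 * \<phi> = (\<phi>\<^sup>2 * s)\<^sup>2"
    unfolding power_mult_distrib s2 phi2 phi_u using u2 by algebra
  then have sqrt2: "sqrt (\<phi>\<^sup>2 + 3 * \<phi>) = \<phi>\<^sup>2 * s"
    using s0 by simp
  have arg_a: "1/2 * sqrt (\<phi>\<^sup>2 + 3 * \<phi>) - (\<phi>\<^sup>2 + 1) / (2 * \<phi>) = y * (1 - b) / u"
  proof -
    have "(\<phi>\<^sup>2 + 1) / (2 * \<phi>) = (\<phi>\<^sup>2 + 1) * u / 2"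
      by (simp add: u_def)
    moreover have "y * (1 - b) / u = y * (1 - b) * \<phi>"
      by (simp add: u_def)
    moreover have "\<phi>\<^sup>2 * s - (\<phi>\<^sup>2 + 1) * u = 2 * (y * (1 - b) * \<phi>)"
    proof -
      have "y = 1 - (1 - b) * (1 + u)"
        using y1 phi_u by simp
      then show ?thesis
        unfolding phi2 phi_u using s_b u2 quad by algebra
    qed
    ultimately show ?thesis
      unfolding sqrt2 by linarith
  qed
  have arg_b: "1 / (2 * \<phi>\<^sup>2) + 1/2 * sqrt ((\<phi>\<^sup>2 + 2) / \<phi>^3) = b"
  proof -
    have "1 / (2 * \<phi>\<^sup>2) = (1 - u) / 2"
      unfolding u2 [symmetric] by (simp add: u_def power_divide)
    then show ?thesis
      by (simp add: b_def s_def add_divide_distrib)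
  qed
  \<comment> \<open>The logarithms in the theorem are taken at the reciprocals of the arguments in
    \<open>five\<close>; the two sign changes cancel in the product.\<close>
  have arg_c: "\<phi>\<^sup>2 / 2 + 1/2 * sqrt ((\<phi>\<^sup>2 + 2) / \<phi>) = inverse ((1 - b) / u)"
  proof -
    have "\<phi>\<^sup>2 + \<phi> * s = 2 * (b * \<phi> + 1)"
      unfolding s_b phi2 phi_u using u2 by algebra
    then have "\<phi>\<^sup>2 / 2 + 1/2 * (\<phi> * s) = b * \<phi> + 1"
      by argo
    moreover have "(b * \<phi> + 1) * (1 - b) = u"
      unfolding phi_u using u2 quad by algebra
    ultimately show ?thesis
      unfolding sqrt1 using b by (simp add: field_simps)
  qed
  have arg_d: "1/2 * \<phi> + 1/2 * sqrt ((\<phi>\<^sup>2 + 2) / \<phi>^3) = inverse ((1 - y) / u)"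
  proof -
    have "1/2 * \<phi> + 1/2 * s = b + u"
      unfolding b_def phi_u by (simp add: field_simps)
    moreover have "(b + u) * (1 - y) = u"
      unfolding y1 phi_u using u2 quad by algebra
    ultimately show ?thesis
      unfolding s_def [symmetric] using y by (simp add: field_simps)
  qed
  have "dilog (u\<^sup>2) = pi\<^sup>2 / 15 - (ln \<phi>)\<^sup>2"
    using dilog_inverse_golden_ratio_squared by (simp add: u_def \<phi>_def power_divide)
  \<comment> \<open>By \<open>e1\<close> the term \<open>dilog y\<close> occurs on both sides of
    \<open>five\<close> and drops out, leaving the difference sought in terms of
    \<open>dilog (u^2)\<close> and the logarithms.\<close>
  then show ?thesis
    unfolding arg_a arg_b arg_c arg_d using five e1 by (simp add: ln_inverse del: inverse_divide)
qed

end
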